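(* Let $d\ge 2$ and for every density matrix $\rho$ on $\mathbb{C}^d$ let $\mathcal{P}(\rho)=d\left(\mathcal{T}^{\max}(\rho)-\mathcal{T}^{\min}(\rho)\right)$, where $\mathcal{T}^{\max}(\rho)$ and $\mathcal{T}^{\min}(\rho)$ are the maximum and the minimum of the texture $\mathcal{T}_{\mathsf{B}}(\rho)$ over all orthonormal bases $\mathsf{B}$ of $\mathbb{C}^d$. Then $\mathcal{P}$ is a valid purity monotone under unital operations, that is: (1) (faithfulness) $\mathcal{P}(\rho)\ge 0$ for every density matrix $\rho$, with $\mathcal{P}(\rho)=0$ if and only if $\rho=\mathbb{I}/d$; (2) (monotonicity) $\mathcal{P}(\Lambda(\rho))\le\mathcal{P}(\rho)$ for every density matrix $\rho$ and every unital operation $\Lambda$ on $\mathbb{C}^d$; (3) (convexity) $\mathcal{P}\left(\sum_k p_k\rho_k\right)\le\sum_k p_k\,\mathcal{P}(\rho_k)$ for every finite family of density matrices $\rho_k$ on $\mathbb{C}^d$ and every probability distribution $(p_k)$.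
   Context: A density matrix on $\mathbb{C}^d$ is a positive semidefinite operator of trace $1$. For an orthonormal basis $\mathsf{B}=\{|i\rangle\}_{i=1}^d$ of $\mathbb{C}^d$, the texture of $\rho$ with respect to $\mathsf{B}$ is $$\mathcal{T}_{\mathsf{B}}(\rho)=1-\frac1d\sum_{i,j=1}^d\langle i|\rho|j\rangle = 1-\langle s_1|\rho|s_1\rangle,\qquad |s_1\rangle=\frac{1}{\sqrt d}\sum_{i=1}^d|i\rangle .$$ A unital operation on $\mathbb{C}^d$ is a completely positive trace-preserving linear map $\Lambda$ on the operators on $\mathbb{C}^d$ with $\Lambda(\mathbb{I})=\mathbb{I}$. *)

theory Defs
  imports "HOL-Analysis.Analysis"
begin

(* Operators on C^d are matrices of type complex^'n^'n acting by *v, with d = CARD('n).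
   The inner product is conjugate-linear in the first argument, so that
   \<langle>u|A|v\<rangle> is cinner u (A *v v). *)

definition cinner :: "complex ^ 'n \<Rightarrow> complex ^ 'n \<Rightarrow> complex" where
  "cinner u v = (\<Sum>i\<in>UNIV. cnj (u $ i) * v $ i)"

definition cscale :: "complex \<Rightarrow> complex ^ 'n ^ 'n \<Rightarrow> complex ^ 'n ^ 'n" where
  "cscale c A = (\<chi> i j. c * A $ i $ j)"

lemma vector_space_cscale: "vector_space cscale"
  by unfold_locales (auto simp: cscale_def vec_eq_iff algebra_simps)

definition positive_semidefinite :: "complex ^ 'n ^ 'n \<Rightarrow> bool" where
  "positive_semidefinite A \<longleftrightarrow> (\<forall>v. cinner v (A *v v) \<in> \<real>\<^sub>\<ge>\<^sub>0)"

definition density_matrix :: "complex ^ 'n ^ 'n \<Rightarrow> bool" where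
  "density_matrix \<rho> \<longleftrightarrow> positive_semidefinite \<rho> \<and> trace \<rho> = 1"

definition orthonormal_basis :: "('n \<Rightarrow> complex ^ 'n) \<Rightarrow> bool" where
  "orthonormal_basis B \<longleftrightarrow>
     (\<forall>i j. cinner (B i) (B j) = (if i = j then 1 else 0)) \<and> vec.span (range B) = UNIV"

(* For a density matrix the double sum is real, so taking Re only changes the type. *)
definition texture :: "('n \<Rightarrow> complex ^ 'n) \<Rightarrow> complex ^ 'n ^ 'n \<Rightarrow> real" where
  "texture B \<rho> =
     1 - 1 / real CARD('n) * Re (\<Sum>i\<in>UNIV. \<Sum>j\<in>UNIV. cinner (B i) (\<rho> *v B j))"

(* Genuine maximum and minimum (attained values), not supremum and infimum. *)
definition texture_max :: "complex ^ 'n ^ 'n \<Rightarrow> real" where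
  "texture_max \<rho> = (GREATEST t. \<exists>B. orthonormal_basis B \<and> t = texture B \<rho>)"

definition texture_min :: "complex ^ 'n ^ 'n \<Rightarrow> real" where
  "texture_min \<rho> = (LEAST t. \<exists>B. orthonormal_basis B \<and> t = texture B \<rho>)"

definition purity :: "complex ^ 'n ^ 'n \<Rightarrow> real" where
  "purity \<rho> = real CARD('n) * (texture_max \<rho> - texture_min \<rho>)"

(* An operator X on C^m \<otimes> C^d is given by its m * m blocks X a b (a, b < m), i.e.
   X = (\<Sum>a<m. \<Sum>b<m. |a\<rangle>\<langle>b| \<otimes> X a b), and a vector of C^m \<otimes> C^d by its m components v a.
   The map id \<otimes> \<Lambda> then applies \<Lambda> to every block. *)

definition block_positive_semidefinite :: "nat \<Rightarrow> (nat \<Rightarrow> nat \<Rightarrow> complex ^ 'n ^ 'n) \<Rightarrow> bool" where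
  "block_positive_semidefinite m X \<longleftrightarrow>
     (\<forall>v. (\<Sum>a<m. \<Sum>b<m. cinner (v a) (X a b *v v b)) \<in> \<real>\<^sub>\<ge>\<^sub>0)"

definition completely_positive :: "(complex ^ 'n ^ 'n \<Rightarrow> complex ^ 'n ^ 'n) \<Rightarrow> bool" where
  "completely_positive \<Lambda> \<longleftrightarrow>
     (\<forall>m X. block_positive_semidefinite m X \<longrightarrow>
            block_positive_semidefinite m (\<lambda>a b. \<Lambda> (X a b)))"

definition unital_operation :: "(complex ^ 'n ^ 'n \<Rightarrow> complex ^ 'n ^ 'n) \<Rightarrow> bool" where
  "unital_operation \<Lambda> \<longleftrightarrow>
     Vector_Spaces.linear cscale cscale \<Lambda> \<and>
     completely_positive \<Lambda> \<and>
     (\<forall>A. trace (\<Lambda> A) = trace A) \<and>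
     \<Lambda> (mat 1) = mat 1"

end

theory Submission
  imports Defs
begin

text \<open>
  Up to a phase, every vector of norm \<open>\<surd>d\<close> is the sum of an orthonormal basis: reflect
  the standard basis in the hyperplane that exchanges its sum with the given vector. Hence
  \<open>purity \<rho>\<close> is the difference of the largest and the smallest value of the quadratic form
  of \<open>\<rho>\<close> on the sphere of radius \<open>\<surd>d\<close>, i.e. \<open>d\<close> times the spread of the spectrum.
  Faithfulness is then polarization. Monotonicity holds because a positive unital map preserves
  the operator inequalities \<open>\<lambda>\<^sub>m\<^sub>i\<^sub>n I \<le> \<rho> \<le> \<lambda>\<^sub>m\<^sub>a\<^sub>x I\<close>, and convexity because the quadratic
  form is linear in \<open>\<rho>\<close>.
\<close>

subsection \<open>The inner product\<close>

lemma cinner_add_left: "cinner (u + v) w = cinner u w + cinner v w"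
  and cinner_add_right: "cinner w (u + v) = cinner w u + cinner w v"
  and cinner_diff_left: "cinner (u - v) w = cinner u w - cinner v w"
  and cinner_diff_right: "cinner w (u - v) = cinner w u - cinner w v"
  by (simp_all add: cinner_def algebra_simps sum.distrib sum_subtractf)

lemma cinner_scale_left: "cinner (c *s u) v = cnj c * cinner u v"
  and cinner_scale_right: "cinner u (c *s v) = c * cinner u v"
  by (simp_all add: cinner_def sum_distrib_left algebra_simps)

lemma cinner_scaleR_right: "cinner u (r *\<^sub>R v) = of_real r * cinner u v"
  by (simp add: cinner_def scaleR_sum_right flip: scaleR_conv_of_real)

lemma cinner_sum_left: "cinner (\<Sum>i\<in>I. f i) v = (\<Sum>i\<in>I. cinner (f i) v)"
  and cinner_sum_right: "cinner v (\<Sum>i\<in>I. f i) = (\<Sum>i\<in>I. cinner v (f i))"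
  by (simp_all add: cinner_def sum_distrib_left sum_distrib_right sum.swap[of _ I])

lemma cnj_cinner: "cnj (cinner u v) = cinner v u"
  by (simp add: cinner_def mult.commute)

lemma cinner_self: "cinner v v = of_real ((norm v)\<^sup>2)"
  by (simp add: cinner_def norm_vec_def L2_set_def sum_nonneg complex_norm_square mult.commute
      del: of_real_power)

lemma cinner_axis: "cinner (axis i 1) v = v $ i"
proof -
  have "cinner (axis i 1) v = (\<Sum>j\<in>UNIV. if j = i then v $ j else 0)"
    unfolding cinner_def by (intro sum.cong) (auto simp: axis_def)
  then show ?thesis by simp
qed

lemma norm_scale: "norm (c *s v) = cmod c * norm (v :: complex ^ 'n)"
  by (simp add: norm_vec_def norm_mult L2_set_right_distrib)

subsection \<open>Sums of orthonormal bases\<close>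

text \<open>The Householder reflection in the hyperplane orthogonal to \<open>w\<close>. For
  \<open>w = 0\<close> division by zero makes it the identity.\<close>

definition reflect :: "complex ^ 'n \<Rightarrow> complex ^ 'n \<Rightarrow> complex ^ 'n" where
  "reflect w x = x - (2 * cinner w x / cinner w w) *s w"

lemma linear_reflect: "Vector_Spaces.linear (*s) (*s) (reflect w)"
  by unfold_locales
    (simp_all add: reflect_def cinner_add_right cinner_scale_right vec_eq_iff algebra_simps
      add_divide_distrib)

lemma cinner_reflect: "cinner (reflect w x) (reflect w y) = cinner x y"
proof (cases "cinner w w = 0")
  case False
  then show ?thesis
    by (simp add: reflect_def cinner_diff_left cinner_diff_right cinner_scale_left
        cinner_scale_right cnj_cinner field_simps)
qed (simp add: reflect_def)

lemma reflect_reflect: "reflect w (reflect w x) = x"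
  by (cases "cinner w w = 0")
    (simp_all add: reflect_def cinner_diff_right cinner_scale_right vec_eq_iff field_simps)

text \<open>With \<open>w = u - v\<close>, equal norms and a real inner product give
  \<open>2 * cinner w u = cinner w w\<close>, so reflecting \<open>u\<close> subtracts
  \<open>w\<close> exactly once. Equal norms alone would not suffice over the complex
  numbers.\<close>

lemma reflect_swap:
  assumes "norm u = norm v" and "cinner u v \<in> \<real>"
  shows "reflect (u - v) u = v"
proof (cases "u = v")
  case False
  have uv: "cinner v u = cinner u v"
    using assms(2) by (metis Reals_cnj_iff cnj_cinner)
  have "cinner (u - v) (u - v) \<noteq> 0"
    using False by (simp add: cinner_self)
  moreover have "2 * cinner (u - v) u = cinner (u - v) (u - v)"
    using assms(1) uv
    by (simp add: cinner_diff_left cinner_diff_right cinner_self[of u] cinner_self[of v])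
  ultimately show ?thesis by (simp add: reflect_def)
qed (simp add: reflect_def)

lemma orthonormal_basis_reflect: "orthonormal_basis (\<lambda>i. reflect w (axis i 1))"
proof -
  have "vec.span (range (\<lambda>i. reflect w (axis i 1)))
      = reflect w ` vec.span (range (\<lambda>i. axis i 1))"
    using vec.linear_span_image[OF linear_reflect] by (metis image_image)
  also have "vec.span (range (\<lambda>i. axis i 1)) = (UNIV :: (complex ^ 'n) set)"
    using span_cart_basis by (simp add: cart_basis_def full_SetCompr_eq)
  \<comment> \<open>An involution is surjective.\<close>
  also have "reflect w ` UNIV = UNIV"
    by (metis reflect_reflect surjI)
  finally show ?thesis
    by (simp add: orthonormal_basis_def cinner_reflect cinner_axis) (simp add: axis_def)
qed

text \<open>Supplies the phase that makes an inner product real, as \<open>reflect_swap\<close>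
  demands.\<close>

lemma exists_unit_phase:
  obtains c where "cmod c = 1" and "c * z \<in> \<real>"
proof
  show "cmod (cis (- Arg z)) = 1" by simp
  have "cis (- Arg z) * z = cis (- Arg z) * (cmod z * cis (Arg z))"
    by (metis rcis_cmod_Arg rcis_def)
  also have "\<dots> = of_real (cmod z)"
    by (simp add: cis_mult algebra_simps)
  finally show "cis (- Arg z) * z \<in> \<real>" by simp
qed

lemma norm_sum_orthonormal_basis:
  fixes B :: "'n::finite \<Rightarrow> complex ^ 'n"
  assumes "orthonormal_basis B"
  shows "norm (\<Sum>i\<in>UNIV. B i) = sqrt CARD('n)"
proof -
  have "complex_of_real ((norm (\<Sum>i\<in>UNIV. B i))\<^sup>2) = of_real CARD('n)"
    using assms
    by (simp only: cinner_self[symmetric])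
      (simp add: cinner_sum_left cinner_sum_right orthonormal_basis_def)
  then have "(norm (\<Sum>i\<in>UNIV. B i))\<^sup>2 = CARD('n)"
    using of_real_eq_iff by blast
  then show ?thesis by (metis norm_ge_zero real_sqrt_unique)
qed

text \<open>The reflection exchanging the sum of the standard basis with \<open>c *s v\<close>
  carries that basis to the required one. The phase \<open>c\<close> does no harm later, since
  quadratic forms do not see it.\<close>

lemma orthonormal_basis_with_sum:
  fixes v :: "complex ^ 'n"
  assumes "norm v = sqrt CARD('n)"
  obtains B c where "orthonormal_basis B" and "cmod c = 1" and "(\<Sum>i\<in>UNIV. B i) = c *s v"
proof -
  define u :: "complex ^ 'n" where "u = (\<Sum>i\<in>UNIV. axis i 1)"
  obtain c where c: "cmod c = 1" "c * cinner u v \<in> \<real>"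
    by (rule exists_unit_phase)
  have "orthonormal_basis (\<lambda>i::'n. axis i 1 :: complex ^ 'n)"
    \<comment> \<open>Reflecting in the zero vector changes nothing, so the standard basis is a
      special case.\<close>
    using orthonormal_basis_reflect[of 0] by (simp add: reflect_def)
  then have "norm u = norm (c *s v)"
    unfolding u_def using assms c(1) by (simp add: norm_sum_orthonormal_basis norm_scale)
  then have "reflect (u - c *s v) u = c *s v"
    using c(2) by (intro reflect_swap) (simp_all add: cinner_scale_right)
  then have "(\<Sum>i\<in>UNIV. reflect (u - c *s v) (axis i 1)) = c *s v"
    by (simp add: u_def vec.linear_sum[OF linear_reflect])
  with orthonormal_basis_reflect c(1) that show thesis by blast
qed

subsection \<open>Purity as the spread of a quadratic form\<close>

definition expval :: "complex ^ 'n ^ 'n \<Rightarrow> complex ^ 'n \<Rightarrow> real" where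
  "expval A v = Re (cinner v (A *v v))"

lemma expval_scale: "expval A (c *s v) = (cmod c)\<^sup>2 * expval A v"
proof -
  have "cinner (c *s v) (A *v (c *s v)) = of_real ((cmod c)\<^sup>2) * cinner v (A *v v)"
    by (simp add: vec.scale cinner_scale_left cinner_scale_right complex_norm_square
        algebra_simps del: of_real_power)
  then show ?thesis by (simp add: expval_def)
qed

lemma scaleR_matrix_vector: "(r *\<^sub>R A) *v v = r *\<^sub>R (A *v v)" for A :: "complex ^ 'n ^ 'm"
  by (simp add: matrix_vector_mult_def vec_eq_iff scaleR_sum_right)

lemma expval_scaleR_matrix: "expval (r *\<^sub>R A) v = r * expval A v"
  by (simp add: expval_def scaleR_matrix_vector cinner_scaleR_right)

lemma expval_diff: "expval (A - B) v = expval A v - expval B v"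
  by (simp add: expval_def matrix_vector_mult_diff_rdistrib cinner_diff_right)

lemma expval_sum: "expval (\<Sum>k\<in>K. A k) v = (\<Sum>k\<in>K. expval (A k) v)"
  by (induction K rule: infinite_finite_induct)
    (simp_all add: expval_def matrix_vector_mult_add_rdistrib cinner_add_right cinner_def[of _ 0])

lemma expval_mat_1: "expval (mat 1) v = (norm v)\<^sup>2"
  by (simp add: expval_def cinner_self)

lemma continuous_on_expval: "continuous_on S (expval A)"
  unfolding expval_def cinner_def matrix_vector_mult_def
  by (simp, intro continuous_intros)

lemma texture_eq_expval:
  "texture B \<rho> = 1 - expval \<rho> (\<Sum>i\<in>UNIV. B i) / CARD('n)" for B :: "'n::finite \<Rightarrow> _"
  unfolding texture_def expval_def cinner_sum_left cinner_sum_right vec.sum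
  by (subst sum.swap) simp

text \<open>Trades optimization over bases for optimization over a sphere, where compactness
  provides extrema.\<close>

lemma texture_values:
  fixes \<rho> :: "complex ^ 'n ^ 'n"
  shows "(\<exists>B. orthonormal_basis B \<and> t = texture B \<rho>) \<longleftrightarrow>
    (\<exists>v \<in> sphere 0 (sqrt CARD('n)). t = 1 - expval \<rho> v / CARD('n))"
proof
  assume "\<exists>v \<in> sphere 0 (sqrt CARD('n)). t = 1 - expval \<rho> v / CARD('n)"
  then obtain v where v: "norm v = sqrt CARD('n)" "t = 1 - expval \<rho> v / CARD('n)"
    by auto
  obtain B c where "orthonormal_basis B" "cmod c = 1" "(\<Sum>i\<in>UNIV. B i) = c *s v"
    using v(1) by (rule orthonormal_basis_with_sum)
  with v(2) show "\<exists>B. orthonormal_basis B \<and> t = texture B \<rho>"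
    by (intro exI[of _ B]) (simp add: texture_eq_expval expval_scale)
qed (auto simp: texture_eq_expval norm_sum_orthonormal_basis)

lemma purity_eq_spread:
  fixes \<rho> :: "complex ^ 'n ^ 'n"
  obtains u v where "norm u = sqrt CARD('n)" and "norm v = sqrt CARD('n)"
    and "purity \<rho> = expval \<rho> u - expval \<rho> v"
    and "\<And>x. norm x = sqrt CARD('n) \<Longrightarrow> expval \<rho> v \<le> expval \<rho> x"
    and "\<And>x. norm x = sqrt CARD('n) \<Longrightarrow> expval \<rho> x \<le> expval \<rho> u"
proof -
  define S :: "(complex ^ 'n) set" where "S = sphere 0 (sqrt CARD('n))"
  have S: "compact S" "S \<noteq> {}" by (simp_all add: S_def)
  obtain u where u: "u \<in> S" "\<And>x. x \<in> S \<Longrightarrow> expval \<rho> x \<le> expval \<rho> u"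
    using continuous_attains_sup[OF S continuous_on_expval] by blast
  obtain v where v: "v \<in> S" "\<And>x. x \<in> S \<Longrightarrow> expval \<rho> v \<le> expval \<rho> x"
    using continuous_attains_inf[OF S continuous_on_expval] by blast
  \<comment> \<open>The minus sign in the texture swaps the roles: the form is smallest where the
    texture is largest.\<close>
  have "texture_max \<rho> = 1 - expval \<rho> v / CARD('n)"
    unfolding texture_max_def texture_values S_def[symmetric]
    using v by (intro Greatest_equality) (auto intro!: divide_right_mono)
  moreover have "texture_min \<rho> = 1 - expval \<rho> u / CARD('n)"
    unfolding texture_min_def texture_values S_def[symmetric]
    using u by (intro Least_equality) (auto intro!: divide_right_mono)
  ultimately have "purity \<rho> = expval \<rho> u - expval \<rho> v"
    by (simp add: purity_def field_simps)
  with u v show thesis by (intro that) (simp_all add: S_def)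
qed

lemma expval_diff_le_purity:
  fixes \<rho> :: "complex ^ 'n ^ 'n"
  assumes "norm x = sqrt CARD('n)" and "norm y = sqrt CARD('n)"
  shows "expval \<rho> x - expval \<rho> y \<le> purity \<rho>"
proof -
  obtain u v where uv: "purity \<rho> = expval \<rho> u - expval \<rho> v"
    "\<And>x. norm x = sqrt CARD('n) \<Longrightarrow> expval \<rho> v \<le> expval \<rho> x"
    "\<And>x. norm x = sqrt CARD('n) \<Longrightarrow> expval \<rho> x \<le> expval \<rho> u"
    by (rule purity_eq_spread[of \<rho>]) (rule that)
  show ?thesis
    using uv(2)[OF assms(2)] uv(3)[OF assms(1)] uv(1) by linarith
qed

lemma purity_nonneg: "purity \<rho> \<ge> 0"
  by (rule purity_eq_spread[of \<rho>]) simp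

text \<open>Both sides are homogeneous of degree two, so rescaling a nonzero \<open>v\<close> to the
  sphere loses nothing.\<close>

lemma expval_le_of_sphere:
  fixes A :: "complex ^ 'n ^ 'n"
  assumes "\<And>x. norm x = sqrt CARD('n) \<Longrightarrow> expval A x \<le> expval B x"
  shows "expval A v \<le> expval B v"
proof (cases "v = 0")
  case False
  define c where "c = complex_of_real (sqrt CARD('n) / norm v)"
  have "norm (c *s v) = sqrt CARD('n)"
    using False by (simp add: norm_scale c_def norm_divide)
  from assms[OF this] have "(cmod c)\<^sup>2 * expval A v \<le> (cmod c)\<^sup>2 * expval B v"
    by (simp add: expval_scale)
  then show ?thesis using False by (simp add: c_def norm_divide)
qed (simp add: expval_def)

subsection \<open>Faithfulness, monotonicity and convexity\<close>

text \<open>Polarization: expanding the form at \<open>axis i 1 + c *s axis j 1\<close> leaves only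
  the cross terms, and \<open>c = 1\<close> and \<open>c = \<i>\<close> together separate the two
  entries.\<close>

lemma quadratic_form_zero_imp_zero:
  fixes A :: "complex ^ 'n ^ 'n"
  assumes "\<And>v. cinner v (A *v v) = 0"
  shows "A = 0"
proof -
  have entry: "cinner (axis i 1) (A *v axis j 1) = A $ i $ j" for i j
    by (simp add: cinner_axis) (simp add: matrix_vector_mult_def axis_def if_distrib cong: if_cong)
  have polar: "c * A $ i $ j + cnj c * A $ j $ i = 0" for i j c
    using assms[of "axis i 1 + c *s axis j 1"] assms[of "axis i 1"] assms[of "axis j 1"]
    by (simp add: vec.add vec.scale cinner_add_left cinner_add_right cinner_scale_left
        cinner_scale_right entry add.commute)
  have "A $ i $ j = 0" for i j
    using polar[of 1 i j] polar[of \<i> i j] by (simp add: algebra_simps)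
  then show ?thesis by (simp add: vec_eq_iff)
qed

text \<open>Splits positivity into reality of the form and a real inequality, so that bounds on
  \<open>expval\<close> can become operator inequalities.\<close>

lemma positive_semidefinite_iff:
  "positive_semidefinite A \<longleftrightarrow> (\<forall>v. cinner v (A *v v) = of_real (expval A v) \<and> expval A v \<ge> 0)"
  by (auto simp: positive_semidefinite_def expval_def complex_nonneg_Reals_iff complex_eq_iff)

lemma purity_eq_0_iff:
  fixes \<rho> :: "complex ^ 'n ^ 'n"
  assumes "density_matrix \<rho>"
  shows "purity \<rho> = 0 \<longleftrightarrow> \<rho> = (1 / real CARD('n)) *\<^sub>R mat 1"
proof
  assume 0: "purity \<rho> = 0"
  obtain u :: "complex ^ 'n" where u: "norm u = sqrt CARD('n)"
    by (rule purity_eq_spread[of \<rho>]) (rule that)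
  define a where "a = expval \<rho> u / CARD('n)"
  \<comment> \<open>Zero spread, applied to the pair in both orders, makes the form constant on the
    sphere, with value \<open>a * CARD('n)\<close>.\<close>
  have const: "expval \<rho> x = expval (a *\<^sub>R mat 1) x" if "norm x = sqrt CARD('n)" for x
    using expval_diff_le_purity[OF that u, of \<rho>] expval_diff_le_purity[OF u that, of \<rho>] 0 that
    by (simp add: expval_scaleR_matrix expval_mat_1 a_def)
  have "expval \<rho> v = expval (a *\<^sub>R mat 1) v" for v
    by (rule order.antisym; rule expval_le_of_sphere) (simp_all add: const)
  \<comment> \<open>Positivity of \<open>\<rho>\<close> makes its form real, so agreement of real
    parts is agreement of the complex values.\<close>
  then have "cinner v ((\<rho> - a *\<^sub>R mat 1) *v v) = 0" for v
    using assms
    by (simp add: density_matrix_def positive_semidefinite_iff matrix_vector_mult_diff_rdistrib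
        cinner_diff_right expval_scaleR_matrix expval_mat_1 cinner_scaleR_right cinner_self
        scaleR_matrix_vector)
  then have \<rho>: "\<rho> = a *\<^sub>R mat 1"
    using quadratic_form_zero_imp_zero by fastforce
  \<comment> \<open>Unit trace now determines \<open>a\<close>.\<close>
  have "trace (a *\<^sub>R mat 1 :: complex ^ 'n ^ 'n) = of_real (a * CARD('n))"
    by (simp add: trace_def mat_def) (simp add: scaleR_conv_of_real mult.commute)
  moreover have "trace (a *\<^sub>R mat 1 :: complex ^ 'n ^ 'n) = 1"
    using assms \<rho> by (simp add: density_matrix_def)
  ultimately have "a * CARD('n) = 1"
    by (metis of_real_eq_1_iff)
  then have "a = 1 / CARD('n)" by (simp add: field_simps)
  with \<rho> show "\<rho> = (1 / real CARD('n)) *\<^sub>R mat 1" by simp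
next
  assume "\<rho> = (1 / real CARD('n)) *\<^sub>R mat 1"
  then have const: "expval \<rho> x = 1" if "norm x = sqrt CARD('n)" for x
    using that by (simp add: expval_scaleR_matrix expval_mat_1)
  show "purity \<rho> = 0"
    by (rule purity_eq_spread[of \<rho>]) (simp add: const)
qed

lemma completely_positive_imp_positive:
  assumes "completely_positive \<Lambda>" and "positive_semidefinite A"
  shows "positive_semidefinite (\<Lambda> A)"
proof -
  \<comment> \<open>Positivity is the one-block case: only the component \<open>v 0\<close> enters,
    so constant families of vectors suffice as tests.\<close>
  have "block_positive_semidefinite 1 (\<lambda>_ _. X) \<longleftrightarrow> positive_semidefinite X" for X :: "complex ^ 'n ^ 'n"
    by (auto simp: block_positive_semidefinite_def positive_semidefinite_def dest: spec[of _ "\<lambda>_. _"])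
  then show ?thesis
    using assms unfolding completely_positive_def by blast
qed

lemma purity_unital_le:
  fixes \<rho> :: "complex ^ 'n ^ 'n"
  assumes "positive_semidefinite \<rho>" and "unital_operation \<Lambda>"
  shows "purity (\<Lambda> \<rho>) \<le> purity \<rho>"
proof -
  interpret \<Lambda>: Vector_Spaces.linear cscale cscale \<Lambda>
    using assms(2) by (simp add: unital_operation_def)
  have cscale_of_real: "cscale (of_real r) A = r *\<^sub>R A" for r A
    by (simp add: cscale_def vec_eq_iff) (simp add: scaleR_conv_of_real)
  have \<Lambda>_mat: "\<Lambda> (r *\<^sub>R mat 1) = r *\<^sub>R mat 1" for r
    using \<Lambda>.scale[of "of_real r" "mat 1"] assms(2)
    by (simp add: cscale_of_real unital_operation_def)
  \<comment> \<open>Reality of the form is the half of positivity that inequalities between values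
    of \<open>expval\<close> cannot give.\<close>
  have quadratic: "cinner v ((r *\<^sub>R mat 1 - \<rho>) *v v) = of_real (expval (r *\<^sub>R mat 1 - \<rho>) v)" for r v
    using assms(1)
    by (simp add: positive_semidefinite_iff matrix_vector_mult_diff_rdistrib expval_diff
        cinner_diff_right expval_scaleR_matrix expval_mat_1 cinner_scaleR_right cinner_self
        scaleR_matrix_vector)
  have quadratic': "cinner v ((\<rho> - r *\<^sub>R mat 1) *v v) = of_real (expval (\<rho> - r *\<^sub>R mat 1) v)" for r v
    using quadratic[of v r]
    by (simp add: matrix_vector_mult_diff_rdistrib cinner_diff_right expval_diff algebra_simps)
  have pos: "positive_semidefinite A \<Longrightarrow> expval (\<Lambda> A) v \<ge> 0" for A v
    using assms(2) completely_positive_imp_positive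
    by (metis positive_semidefinite_iff unital_operation_def)

  obtain u v where uv: "purity \<rho> = expval \<rho> u - expval \<rho> v"
    "\<And>x. norm x = sqrt CARD('n) \<Longrightarrow> expval \<rho> v \<le> expval \<rho> x"
    "\<And>x. norm x = sqrt CARD('n) \<Longrightarrow> expval \<rho> x \<le> expval \<rho> u"
    by (rule purity_eq_spread[of \<rho>]) (rule that)
  \<comment> \<open>The extreme Rayleigh quotients \<open>a\<close> and \<open>b\<close> of
    \<open>\<rho>\<close> give \<open>b I \<le> \<rho> \<le> a I\<close>, which
    \<open>\<Lambda>\<close> preserves because it is positive and fixes multiples of the
    identity.\<close>
  define a where "a = expval \<rho> u / CARD('n)"
  define b where "b = expval \<rho> v / CARD('n)"
  have "expval \<rho> x \<le> expval (a *\<^sub>R mat 1) x" "expval (b *\<^sub>R mat 1) x \<le> expval \<rho> x" for x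
    by (rule expval_le_of_sphere;
        use uv(2,3) in \<open>simp add: expval_scaleR_matrix expval_mat_1 a_def b_def\<close>)+
  then have "positive_semidefinite (a *\<^sub>R mat 1 - \<rho>)" "positive_semidefinite (\<rho> - b *\<^sub>R mat 1)"
    unfolding positive_semidefinite_iff quadratic quadratic' by (simp_all add: expval_diff)
  from this[THEN pos]
  have bounds: "expval (\<Lambda> \<rho>) x \<le> a * (norm x)\<^sup>2" "b * (norm x)\<^sup>2 \<le> expval (\<Lambda> \<rho>) x" for x
    by (simp_all add: \<Lambda>.diff \<Lambda>_mat expval_diff expval_scaleR_matrix expval_mat_1)
  \<comment> \<open>On extremal vectors of \<open>\<Lambda> \<rho>\<close>, whose squared norm is
    \<open>CARD('n)\<close>, the bounds yield \<open>CARD('n) * (a - b)\<close>, the purity of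
    \<open>\<rho>\<close>.\<close>
  obtain x y where "norm x = sqrt CARD('n)" "norm y = sqrt CARD('n)"
    "purity (\<Lambda> \<rho>) = expval (\<Lambda> \<rho>) x - expval (\<Lambda> \<rho>) y"
    by (rule purity_eq_spread[of "\<Lambda> \<rho>"])
  then show ?thesis
    using bounds(1)[of x] bounds(2)[of y] by (simp add: uv(1) a_def b_def)
qed

text \<open>Vectors extremal for the mixture are merely admissible for each \<open>\<rho> k\<close>,
  so each difference of values is at most the purity of that component.\<close>

lemma purity_convex:
  fixes \<rho> :: "'k \<Rightarrow> complex ^ 'n ^ 'n"
  assumes "\<And>k. k \<in> K \<Longrightarrow> p k \<ge> 0"
  shows "purity (\<Sum>k\<in>K. p k *\<^sub>R \<rho> k) \<le> (\<Sum>k\<in>K. p k * purity (\<rho> k))"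
proof -
  let ?\<sigma> = "\<Sum>k\<in>K. p k *\<^sub>R \<rho> k"
  obtain u v where uv: "norm u = sqrt CARD('n)" "norm v = sqrt CARD('n)"
    "purity ?\<sigma> = expval ?\<sigma> u - expval ?\<sigma> v"
    by (rule purity_eq_spread[of ?\<sigma>])
  have "purity ?\<sigma> = (\<Sum>k\<in>K. p k * (expval (\<rho> k) u - expval (\<rho> k) v))"
    by (simp add: uv(3) expval_sum expval_scaleR_matrix sum_subtractf right_diff_distrib)
  also have "\<dots> \<le> (\<Sum>k\<in>K. p k * purity (\<rho> k))"
    using assms uv(1,2) by (intro sum_mono mult_left_mono expval_diff_le_purity)
  finally show ?thesis .
qed

theorem theorem1:
  assumes "CARD('n::finite) \<ge> 2"
  shows
    "(\<forall>\<rho> :: complex ^ 'n ^ 'n. density_matrix \<rho> \<longrightarrow>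
        purity \<rho> \<ge> 0 \<and> (purity \<rho> = 0 \<longleftrightarrow> \<rho> = (1 / real CARD('n)) *\<^sub>R mat 1)) \<and>
     (\<forall>(\<rho> :: complex ^ 'n ^ 'n) \<Lambda>. density_matrix \<rho> \<longrightarrow> unital_operation \<Lambda> \<longrightarrow>
        purity (\<Lambda> \<rho>) \<le> purity \<rho>) \<and>
     (\<forall>(K :: 'k set) (p :: 'k \<Rightarrow> real) (\<rho> :: 'k \<Rightarrow> complex ^ 'n ^ 'n).
        finite K \<longrightarrow> (\<forall>k\<in>K. density_matrix (\<rho> k)) \<longrightarrow>
        (\<forall>k\<in>K. p k \<ge> 0) \<longrightarrow> (\<Sum>k\<in>K. p k) = 1 \<longrightarrow>
        purity (\<Sum>k\<in>K. p k *\<^sub>R \<rho> k) \<le> (\<Sum>k\<in>K. p k * purity (\<rho> k)))"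
  by (auto simp: purity_nonneg purity_eq_0_iff density_matrix_def
      intro: purity_unital_le purity_convex)

end
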